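(* Consider the uncertain linear system with real matrices $A\in\mathbf{R}^{n\times n}$, $B_1\in\mathbf{R}^{n\times m}$, $B_2\in\mathbf{R}^{n\times r}$, $C_1\in\mathbf{R}^{h\times n}$, $D_1\in\mathbf{R}^{h\times m}$, $C_2\in\mathbf{R}^{l\times n}$, $D_2\in\mathbf{R}^{l\times r}$, as described in the context. Suppose that $H(s)=C_1(sI-A)^{-1}B_1+D_1\not\equiv 0$. Then a non-zero state $x_0\in\mathbf{R}^n$ is differentially possibly controllable if and only if $x_0$ is a controllable state for the pair $(A,[B_1\ \ B_2])$.
   Context: System: $\dot x(t)=Ax(t)+B_1u(t)+B_2\xi(t)$, $z(t)=C_1x(t)+D_1u(t)$, $y(t)=C_2x(t)+D_2\xi(t)$, where $x\in\mathbf{R}^n$ is the state, $u\in\mathbf{R}^m$ the control input, $\xi\in\mathbf{R}^r$ the uncertainty input, $z\in\mathbf{R}^h$ the uncertainty output and $y\in\mathbf{R}^l$ the measured output. Averaged integral quadratic constraint: let $T>0$ and $d>0$. For any integer $q\ge 1$, consider sequences of uncertainty inputs $\{\xi^1,\dots,\xi^q\}$ and of control inputs $\{u^1,\dots,u^q\}$ with $\xi^i,u^i\in \mathbf{L}_2[0,T]$, and let $x^i,z^i$ be the corresponding state and uncertainty output on $[0,T]$ with $x^i(0)=x_0$. The sequence is admissible (for the given $d$) if $$\frac1q\sum_{i=1}^q\int_0^T\left(\|\xi^i(t)\|^2-\|z^i(t)\|^2\right)dt\le d.$$ Possible controllability function: $$L_c(x_0,T)=\sup_{\epsilon>0}\ \inf\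 \frac1q\sum_{i=1}^q\left[\frac{\|x^i(T)\|^2}{\epsilon}+\int_0^T\|u^i(t)\|^2dt\right],$$ where the infimum is over all $q\ge1$ and all admissible sequences $\{\xi^i\}_{i=1}^q$, $\{u^i\}_{i=1}^q$ with $x^i(0)=x_0$. It depends on $d$. A non-zero state $x_0$ is possibly controllable on $[0,T]$ if $\sup_{d>0}L_c(x_0,T)<\infty$. It is (differentially) possibly controllable if it is possibly controllable on $[0,T]$ for all sufficiently small $T>0$. A state $x_0$ is a controllable state for a pair $(A,B)$ if it lies in the controllable subspace of $(A,B)$, i.e. the range of $[B\ AB\ \cdots\ A^{n-1}B]$. *)

theory Defs
  imports "HOL-Analysis.Analysis"
begin

definition square_integrable_on :: "(real \<Rightarrow> real ^ 'k) \<Rightarrow> real \<Rightarrow> bool" where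
  "square_integrable_on f T \<longleftrightarrow>
     f \<in> borel_measurable (lebesgue_on {0..T}) \<and>
     integrable (lebesgue_on {0..T}) (\<lambda>t. (norm (f t))\<^sup>2)"

(* Since the inputs are only L2, the differential equation is understood in the sense of
   Caratheodory: x is absolutely continuous and the equation holds almost everywhere. This is
   stated in integrated form; has_integral makes existence of the integral part of the
   condition (and forces x to be continuous on {0..T}). *)
definition trajectory ::
  "real ^ 'n ^ 'n \<Rightarrow> real ^ 'm ^ 'n \<Rightarrow> real ^ 'r ^ 'n \<Rightarrow> real ^ 'n ^ 'h \<Rightarrow> real ^ 'm ^ 'h \<Rightarrow>
   real ^ 'n ^ 'l \<Rightarrow> real ^ 'r ^ 'l \<Rightarrow> real \<Rightarrow>
   (real \<Rightarrow> real ^ 'm) \<Rightarrow> (real \<Rightarrow> real ^ 'r) \<Rightarrow>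
   (real \<Rightarrow> real ^ 'n) \<Rightarrow> (real \<Rightarrow> real ^ 'h) \<Rightarrow> (real \<Rightarrow> real ^ 'l) \<Rightarrow> bool" where
  "trajectory A B1 B2 C1 D1 C2 D2 T u \<xi> x z y \<longleftrightarrow>
     square_integrable_on u T \<and> square_integrable_on \<xi> T \<and>
     (\<forall>t\<in>{0..T}.
        ((\<lambda>s. A *v x s + B1 *v u s + B2 *v \<xi> s) has_integral (x t - x 0)) {0..t} \<and>
        z t = C1 *v x t + D1 *v u t \<and>
        y t = C2 *v x t + D2 *v \<xi> t)"

(* The averaged integral quadratic constraint, for sequences indexed by {1..q}, together with
   the common initial state x0. *)
definition admissible ::
  "real ^ 'n ^ 'n \<Rightarrow> real ^ 'm ^ 'n \<Rightarrow> real ^ 'r ^ 'n \<Rightarrow> real ^ 'n ^ 'h \<Rightarrow> real ^ 'm ^ 'h \<Rightarrow>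
   real ^ 'n ^ 'l \<Rightarrow> real ^ 'r ^ 'l \<Rightarrow> real \<Rightarrow> real ^ 'n \<Rightarrow> real \<Rightarrow> nat \<Rightarrow>
   (nat \<Rightarrow> real \<Rightarrow> real ^ 'm) \<Rightarrow> (nat \<Rightarrow> real \<Rightarrow> real ^ 'r) \<Rightarrow>
   (nat \<Rightarrow> real \<Rightarrow> real ^ 'n) \<Rightarrow> (nat \<Rightarrow> real \<Rightarrow> real ^ 'h) \<Rightarrow> (nat \<Rightarrow> real \<Rightarrow> real ^ 'l) \<Rightarrow> bool" where
  "admissible A B1 B2 C1 D1 C2 D2 d x0 T q u \<xi> x z y \<longleftrightarrow>
     (\<forall>i\<in>{1..q}. trajectory A B1 B2 C1 D1 C2 D2 T (u i) (\<xi> i) (x i) (z i) (y i) \<and> x i 0 = x0) \<and>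
     1 / real q * (\<Sum>i=1..q. LINT t|lebesgue_on {0..T}. (norm (\<xi> i t))\<^sup>2 - (norm (z i t))\<^sup>2) \<le> d"

definition averaged_cost ::
  "real \<Rightarrow> real \<Rightarrow> nat \<Rightarrow> (nat \<Rightarrow> real \<Rightarrow> real ^ 'm) \<Rightarrow> (nat \<Rightarrow> real \<Rightarrow> real ^ 'n) \<Rightarrow> real" where
  "averaged_cost \<epsilon> T q u x =
     1 / real q * (\<Sum>i=1..q. (norm (x i T))\<^sup>2 / \<epsilon> + (LINT t|lebesgue_on {0..T}. (norm (u i t))\<^sup>2))"

definition possible_controllability_function ::
  "real ^ 'n ^ 'n \<Rightarrow> real ^ 'm ^ 'n \<Rightarrow> real ^ 'r ^ 'n \<Rightarrow> real ^ 'n ^ 'h \<Rightarrow> real ^ 'm ^ 'h \<Rightarrow>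
   real ^ 'n ^ 'l \<Rightarrow> real ^ 'r ^ 'l \<Rightarrow> real \<Rightarrow> real ^ 'n \<Rightarrow> real \<Rightarrow> ereal" where
  "possible_controllability_function A B1 B2 C1 D1 C2 D2 d x0 T =
     (SUP \<epsilon>\<in>{0<..}. Inf {ereal (averaged_cost \<epsilon> T q u x) | q u \<xi> x z y.
        q \<ge> 1 \<and> admissible A B1 B2 C1 D1 C2 D2 d x0 T q u \<xi> x z y})"

definition possibly_controllable_on ::
  "real ^ 'n ^ 'n \<Rightarrow> real ^ 'm ^ 'n \<Rightarrow> real ^ 'r ^ 'n \<Rightarrow> real ^ 'n ^ 'h \<Rightarrow> real ^ 'm ^ 'h \<Rightarrow>
   real ^ 'n ^ 'l \<Rightarrow> real ^ 'r ^ 'l \<Rightarrow> real ^ 'n \<Rightarrow> real \<Rightarrow> bool" where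
  "possibly_controllable_on A B1 B2 C1 D1 C2 D2 x0 T \<longleftrightarrow>
     x0 \<noteq> 0 \<and>
     (SUP d\<in>{0<..}. possible_controllability_function A B1 B2 C1 D1 C2 D2 d x0 T) < \<infinity>"

definition differentially_possibly_controllable ::
  "real ^ 'n ^ 'n \<Rightarrow> real ^ 'm ^ 'n \<Rightarrow> real ^ 'r ^ 'n \<Rightarrow> real ^ 'n ^ 'h \<Rightarrow> real ^ 'm ^ 'h \<Rightarrow>
   real ^ 'n ^ 'l \<Rightarrow> real ^ 'r ^ 'l \<Rightarrow> real ^ 'n \<Rightarrow> bool" where
  "differentially_possibly_controllable A B1 B2 C1 D1 C2 D2 x0 \<longleftrightarrow>
     (\<forall>\<^sub>F T in at_right 0. possibly_controllable_on A B1 B2 C1 D1 C2 D2 x0 T)"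

definition transfer_function ::
  "real ^ 'n ^ 'n \<Rightarrow> real ^ 'm ^ 'n \<Rightarrow> real ^ 'n ^ 'h \<Rightarrow> real ^ 'm ^ 'h \<Rightarrow> complex \<Rightarrow> complex ^ 'm ^ 'h" where
  "transfer_function A B C D s =
     map_matrix of_real C ** matrix_inv (mat s - map_matrix of_real A) ** map_matrix of_real B
       + map_matrix of_real D"

(* A rational matrix function is compared with 0 only where the resolvent exists;
   matrix_inv is unspecified at the eigenvalues of A. *)
definition transfer_function_nonzero ::
  "real ^ 'n ^ 'n \<Rightarrow> real ^ 'm ^ 'n \<Rightarrow> real ^ 'n ^ 'h \<Rightarrow> real ^ 'm ^ 'h \<Rightarrow> bool" where
  "transfer_function_nonzero A B C D \<longleftrightarrow>
     (\<exists>s. invertible (mat s - map_matrix of_real A :: complex ^ 'n ^ 'n) \<and>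
          transfer_function A B C D s \<noteq> 0)"

definition block_row :: "'a ^ 'm ^ 'n \<Rightarrow> 'a ^ 'r ^ 'n \<Rightarrow> 'a ^ ('m + 'r) ^ 'n" where
  "block_row B1 B2 = (\<chi> i j. case j of Inl a \<Rightarrow> B1 $ i $ a | Inr b \<Rightarrow> B2 $ i $ b)"

(* The power notation on real ^ 'n ^ 'n is componentwise, so matrix powers are spelled out. *)
definition matrix_power :: "real ^ 'n ^ 'n \<Rightarrow> nat \<Rightarrow> real ^ 'n ^ 'n" where
  "matrix_power A k = (((**) A) ^^ k) (mat 1)"

(* The range of [B, A B, ..., A^(n-1) B], where w k is the k-th block of the argument. *)
definition controllable_subspace :: "real ^ 'n ^ 'n \<Rightarrow> real ^ 'p ^ 'n \<Rightarrow> (real ^ 'n) set" where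
  "controllable_subspace A B =
     range (\<lambda>w :: nat \<Rightarrow> real ^ 'p. \<Sum>k<CARD('n). (matrix_power A k ** B) *v w k)"

definition controllable_state :: "real ^ 'n ^ 'n \<Rightarrow> real ^ 'p ^ 'n \<Rightarrow> real ^ 'n \<Rightarrow> bool" where
  "controllable_state A B x \<longleftrightarrow> x \<in> controllable_subspace A B"

end

(* Sufficiency. Let b = B w and let q(s) = sum_j q_j s^j be monic with q(A) b = 0. Writing
   q(s) - q(A) = (s - A) E(s), every scalar function psi gives the trajectory x = E(D) psi b driven
   by the input q(D) psi w, where D is differentiation. Polynomials psi with prescribed jets at
   0 and T steer every controllable state to 0 (with B = [B1 B2]), and a psi vanishing to high order
   at both ends gives a loop from 0 to 0 (with B = B1) whose uncertainty output is nonzero because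
   H is. Adding a large multiple of the loop to the steering trajectory makes the integral of
   |z|^2 exceed that of |xi|^2, so a single trajectory ending in 0 is admissible for every d > 0,
   and its cost depends neither on d nor on epsilon.

   Necessity. If P is a projection with kernel the controllable subspace, then p = P x satisfies
   p' = P A p whatever the inputs are, so p(T) is bounded away from 0 when P x0 is nonzero and
   T is small, and the terminal cost is unbounded as epsilon tends to 0. *)

theory Submission
  imports Defs "HOL-Computational_Algebra.Polynomial_Factorial"
    "HOL-Computational_Algebra.Field_as_Ring"
begin

section \<open>Cyclic subspaces of \<open>A\<close> and the controllable subspace they span\<close>

section \<open>Krylov subspaces\<close>

lemma matrix_power_mult_vec: "matrix_power A k *v x = ((*v) A ^^ k) x"
  unfolding matrix_power_def
  by (induction k) (simp_all add: matrix_vector_mul_assoc[symmetric])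

lemma linear_funpow: "linear ((*v) (A :: real ^ 'n ^ 'n) ^^ k)"
  proof (induction k)
  case 0
  show ?case using linear_id by (simp add: id_def)
next
  case (Suc k)
  then show ?case using linear_compose[OF Suc matrix_vector_mul_linear, of A] by (simp add: o_def)
qed

text \<open>A vectorwise substitute for Cayley-Hamilton. By dimension, some \<open>A^m b\<close>
  with \<open>m\<close> at most the dimension depends on its predecessors; their span is then
  invariant under \<open>A\<close> and contains \<open>b\<close>, hence all later iterates.\<close>

lemma funpow_in_span_funpow_lessThan_card:
  fixes A :: "real ^ 'n ^ 'n"
  shows "((*v) A ^^ k) b \<in> span ((\<lambda>j. ((*v) A ^^ j) b) ` {..<CARD('n)})"
proof -
  define S where "S m = (\<lambda>j. ((*v) A ^^ j) b) ` {..<m}" for m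
  have "\<exists>m\<le>CARD('n). ((*v) A ^^ m) b \<in> span (S m)"
  proof (rule ccontr)
    assume *: "\<not> ?thesis"
    have "m \<le> Suc CARD('n) \<Longrightarrow> dim (S m) = m" for m
    proof (induction m)
      case 0
      then show ?case by (simp add: S_def)
    next
      case (Suc m)
      have "S (Suc m) = insert (((*v) A ^^ m) b) (S m)"
        by (simp add: S_def lessThan_Suc)
      with Suc * show ?case by (simp add: dim_insert)
    qed
    from this[of "Suc CARD('n)"] dim_subset_UNIV[of "S (Suc CARD('n))"] show False by simp
  qed
  then obtain m where m: "m \<le> CARD('n)" "((*v) A ^^ m) b \<in> span (S m)" by blast
  have inv: "A *v v \<in> span (S m)" if "v \<in> span (S m)" for v
  proof -
    have "(*v) A ` S m \<subseteq> span (S m)"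
    proof (clarsimp simp: S_def)
      fix j assume "j < m"
      then have "Suc j < m \<or> Suc j = m" by auto
      then show "A *v ((*v) A ^^ j) b \<in> span ((\<lambda>j. ((*v) A ^^ j) b) ` {..<m})"
      proof
        assume "Suc j < m"
        then show ?thesis by (intro span_base image_eqI[of _ _ "Suc j"]) auto
      next
        assume "Suc j = m"
        then show ?thesis using m(2) by (auto simp: S_def)
      qed
    qed
    then have "(*v) A ` span (S m) \<subseteq> span (S m)"
      by (metis linear_span_image matrix_vector_mul_linear span_minimal subspace_span)
    with that show ?thesis by blast
  qed
  have "((*v) A ^^ k) b \<in> span (S m)"
  proof (induction k)
    case 0
    show ?case
    \<comment> \<open>For \<open>m = 0\<close> the span is trivial, so membership of
      \<open>A^0 b\<close> says that \<open>b\<close> is 0.\<close>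
    proof (cases m)
      case 0 with m(2) show ?thesis by simp
    next
      case (Suc m')
      then show ?thesis by (auto simp: S_def intro!: span_base image_eqI[of _ _ 0])
    qed
  qed (use inv in auto)
  also have "span (S m) \<subseteq> span (S CARD('n))"
    using m(1) by (intro span_mono) (auto simp: S_def)
  finally show ?thesis by (simp add: S_def)
qed

text \<open>Coefficients are indexed by position and not by vector, since \<open>f\<close> may take
  the same value twice.\<close>

lemma span_image_lessThan:
  fixes f :: "nat \<Rightarrow> 'a::real_vector"
  assumes "v \<in> span (f ` {..<n})"
  obtains c where "v = (\<Sum>i<n. c i *\<^sub>R f i)"
proof -
  let ?R = "range (\<lambda>c. \<Sum>i<n. c i *\<^sub>R f i)"
  have "subspace ?R"
  proof (rule subspaceI; (elim rangeE, hypsubst)?)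
    show "0 \<in> ?R" by (rule range_eqI[of _ _ "\<lambda>_. 0"]) simp
    show "(\<Sum>i<n. c i *\<^sub>R f i) + (\<Sum>i<n. d i *\<^sub>R f i) \<in> ?R" for c d
      by (rule range_eqI[of _ _ "\<lambda>i. c i + d i"]) (simp add: sum.distrib scaleR_left_distrib)
    show "a *\<^sub>R (\<Sum>i<n. c i *\<^sub>R f i) \<in> ?R" for a c
      by (rule range_eqI[of _ _ "\<lambda>i. a * c i"]) (simp add: scaleR_sum_right)
  qed
  moreover have "f ` {..<n} \<subseteq> ?R"
  proof clarsimp
    fix j assume "j < n"
    then show "f j \<in> ?R"
      by (intro range_eqI[of _ _ "\<lambda>i. if i = j then 1 else 0"])
        (simp add: if_distrib[of "\<lambda>a. a *\<^sub>R _"] cong: if_cong)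
  qed
  ultimately have "v \<in> ?R" using assms span_minimal by blast
  then show ?thesis using that by blast
qed

lemma controllable_subspace_iff:
  fixes A :: "real ^ 'n ^ 'n"
  shows "v \<in> controllable_subspace A B \<longleftrightarrow> (\<exists>w. v = (\<Sum>k<CARD('n). ((*v) A ^^ k) (B *v w k)))"
  unfolding controllable_subspace_def
  by (auto simp: matrix_vector_mul_assoc[symmetric] matrix_power_mult_vec)

lemma subspace_controllable_subspace: "subspace (controllable_subspace A B)"
  unfolding controllable_subspace_def
proof (rule subspaceI; (elim rangeE, hypsubst)?)
  let ?g = "\<lambda>w. \<Sum>k<CARD('a). (matrix_power A k ** B) *v w k"
  show "0 \<in> range ?g" by (rule range_eqI[of _ _ "\<lambda>_. 0"]) simp
  show "?g v + ?g w \<in> range ?g" for v w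
    by (rule range_eqI[of _ _ "\<lambda>i. v i + w i"]) (simp add: sum.distrib matrix_vector_right_distrib)
  show "a *\<^sub>R ?g w \<in> range ?g" for a w
    by (rule range_eqI[of _ _ "\<lambda>i. a *\<^sub>R w i"])
      (simp add: scaleR_sum_right linear_scale[OF matrix_vector_mul_linear])
qed

text \<open>The defining sum stops at exponent n-1. The dependence of higher iterates on lower ones,
  applied to \<open>b = B w\<close>, removes this limit and so makes the subspace invariant under
  \<open>A\<close>.\<close>

lemma funpow_in_controllable_subspace:
  fixes A :: "real ^ 'n ^ 'n"
  shows "((*v) A ^^ k) (B *v w) \<in> controllable_subspace A B"
proof -
  have "(\<lambda>j. ((*v) A ^^ j) (B *v w)) ` {..<CARD('n)} \<subseteq> controllable_subspace A B"
  proof clarify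
    fix j :: nat assume "j < CARD('n)"
    then show "((*v) A ^^ j) (B *v w) \<in> controllable_subspace A B"
      unfolding controllable_subspace_iff
      by (intro exI[of _ "\<lambda>i. if i = j then w else 0"])
        (simp add: if_distrib[of "\<lambda>a. (_ *v a)"] if_distrib[of "\<lambda>a. ((_ ^^ _) a)"]
            linear_0[OF linear_funpow] cong: if_cong)
  qed
  with funpow_in_span_funpow_lessThan_card subspace_controllable_subspace show ?thesis
    using span_minimal by blast
qed

lemma controllable_subspace_invariant:
  fixes A :: "real ^ 'n ^ 'n"
  assumes "v \<in> controllable_subspace A B"
  shows "A *v v \<in> controllable_subspace A B"
proof -
  obtain w where "v = (\<Sum>k<CARD('n). ((*v) A ^^ k) (B *v w k))"
    using assms unfolding controllable_subspace_iff by blast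
  then have "A *v v = (\<Sum>k<CARD('n). ((*v) A ^^ Suc k) (B *v w k))"
    by (simp add: linear_sum[OF matrix_vector_mul_linear])
  then show ?thesis
    using funpow_in_controllable_subspace
    by (simp only:) (intro subspace_sum subspace_controllable_subspace; blast)
qed

lemma controllable_subspace_subset:
  fixes A :: "real ^ 'n ^ 'n"
  assumes "subspace V" "\<And>w k. ((*v) A ^^ k) (B *v w) \<in> V"
  shows "controllable_subspace A B \<subseteq> V"
  using assms unfolding controllable_subspace_iff subset_iff by (blast intro: subspace_sum)

(* The f j are the Horner partial sums of q(A) b = 0, and the coefficients of E(s) b
   are f 1, ..., f n. *)
lemma krylov_chain:
  fixes A :: "real ^ 'n ^ 'n"
  obtains f q where "f 0 = 0" "f CARD('n) = b" "q CARD('n) = 1"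
    "\<And>j. j < CARD('n) \<Longrightarrow> A *v f (Suc j) = f j - q j *\<^sub>R b"
proof -
  let ?n = "CARD('n)" and ?p = "\<lambda>j. ((*v) A ^^ j) b"
  obtain c where c: "?p ?n = (\<Sum>i<?n. c i *\<^sub>R ?p i)"
    using span_image_lessThan[OF funpow_in_span_funpow_lessThan_card] by blast
  \<comment> \<open>Coefficients of the monic polynomial of degree n that annihilates
    \<open>b\<close>; beyond index n the value is never read.\<close>
  define q where "q i = (if i < ?n then - c i else 1)" for i
  define f where "f j = (\<Sum>i=j..?n. q i *\<^sub>R ?p (i - j))" for j
  have "(\<Sum>i\<le>?n. q i *\<^sub>R ?p i) = 0"
    by (simp add: lessThan_Suc_atMost[symmetric] q_def c sum_negf)
  then have "f 0 = 0" by (simp add: f_def atLeast0AtMost)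
  moreover have "f ?n = b" by (simp add: f_def q_def)
  moreover have "A *v f (Suc j) = f j - q j *\<^sub>R b" if "j < ?n" for j
  proof -
    have "f j = q j *\<^sub>R b + (\<Sum>i=Suc j..?n. q i *\<^sub>R ?p (i - j))"
      unfolding f_def using that by (subst sum.atLeast_Suc_atMost) auto
    also have "(\<Sum>i=Suc j..?n. q i *\<^sub>R ?p (i - j)) = (\<Sum>i=Suc j..?n. q i *\<^sub>R (A *v ?p (i - Suc j)))"
    proof (rule sum.cong)
      fix i assume "i \<in> {Suc j..?n}"
      then have "i - j = Suc (i - Suc j)" by auto
      then show "q i *\<^sub>R ?p (i - j) = q i *\<^sub>R (A *v ?p (i - Suc j))" by simp
    qed simp
    also have "\<dots> = A *v f (Suc j)"
      by (simp add: f_def linear_sum[OF matrix_vector_mul_linear] linear_scale[OF matrix_vector_mul_linear])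
    finally show ?thesis by simp
  qed
  ultimately show ?thesis using that[of f q] by (simp add: q_def)
qed

section \<open>Polynomials with prescribed jets, and independence of successive derivatives\<close>

section \<open>Higher derivatives of polynomials\<close>

text \<open>One differentiation lowers the multiplicity of a factor by at most one, by the product
  rule; the induction hypothesis is therefore used at \<open>Suc k\<close>.\<close>

lemma power_dvd_higher_pderiv:
  fixes p :: "real poly"
  assumes "r ^ (j + k) dvd p"
  shows "r ^ k dvd (pderiv ^^ j) p"
  using assms
proof (induction j arbitrary: k)
  case 0
  then show ?case by simp
next
  case (Suc j)
  from Suc.IH[of "Suc k"] Suc.prems obtain s where "(pderiv ^^ j) p = r ^ Suc k * s"
    by (auto elim: dvdE)
  then have "(pderiv ^^ Suc j) p = r ^ Suc k * pderiv s + s * smult (of_nat (Suc k)) (r ^ k) * pderiv r"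
    by (simp only: funpow.simps o_apply pderiv_mult pderiv_power_Suc mult_ac)
  also have "r ^ k dvd \<dots>"
    by (intro dvd_add) (simp_all add: dvd_mult dvd_mult2 dvd_smult)
  finally show ?case .
qed

lemma poly_higher_pderiv_eq_0:
  fixes p :: "real poly"
  assumes "[:-a, 1:] ^ N dvd p" "j < N"
  shows "poly ((pderiv ^^ j) p) a = 0"
proof -
  have "[:-a, 1:] ^ (j + 1) dvd p"
    using assms by (metis Suc_eq_plus1 Suc_leI dvd_trans le_imp_power_dvd)
  from power_dvd_higher_pderiv[OF this] show ?thesis
    by (simp add: poly_eq_0_iff_dvd)
qed

lemma poly_higher_pderiv_0:
  fixes p :: "real poly"
  shows "poly ((pderiv ^^ j) p) 0 = fact j * coeff p j"
  by (simp add: poly_0_coeff_0 coeff_higher_pderiv pochhammer_fact)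

text \<open>The powers \<open>X^N\<close> and \<open>(X - a)^N\<close> are coprime, so Bezout gives
  \<open>c\<close> congruent to 1 modulo the first and to 0 modulo the second. Multiplying
  \<open>c\<close> by \<open>X^m / m!\<close> gives the required jets.\<close>

lemma hermite_interpolation:
  fixes a :: real
  assumes "a \<noteq> 0" "m < N"
  obtains p :: "real poly" where
    "\<And>j. j < N \<Longrightarrow> poly ((pderiv ^^ j) p) 0 = (if j = m then 1 else 0)"
    "\<And>j. j < N \<Longrightarrow> poly ((pderiv ^^ j) p) a = 0"
proof -
  have "coprime [:0, 1::real:] [:-a, 1:]"
  proof (rule coprimeI)
    fix c assume "c dvd [:0, 1:]" "c dvd [:-a, 1:]"
    then have "c dvd [:0, 1:] - [:-a, 1:]" by (rule dvd_diff)
    then have "c dvd [:a:]" by simp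
    moreover have "[:a:] dvd 1" using assms(1) by (intro dvdI[of _ _ "[:1 / a:]"]) simp
    ultimately show "is_unit c" by (rule dvd_trans)
  qed
  then have "coprime ([:0, 1:] ^ N) ([:-a, 1:] ^ N)" by simp
  then obtain r s where rs: "r * [:0, 1:] ^ N + s * [:-a, 1:] ^ N = 1"
    by (metis bezout_coefficients_fst_snd coprime_imp_gcd_eq_1)
  define c where "c = s * [:-a, 1:] ^ N"
  have c: "c = 1 - monom 1 N * r"
    using rs by (simp add: c_def monom_altdef algebra_simps)
  define p where "p = monom (1 / fact m) m * c"
  have "poly ((pderiv ^^ j) p) 0 = (if j = m then 1 else 0)" if "j < N" for j
  proof -
    have "coeff c i = (if i = 0 then 1 else 0)" if "i < N" for i
      using that by (simp add: c coeff_monom_mult coeff_diff)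
    then show ?thesis
      using that by (simp add: poly_higher_pderiv_0 p_def coeff_monom_mult)
  qed
  moreover have "poly ((pderiv ^^ j) p) a = 0" if "j < N" for j
    using that by (intro poly_higher_pderiv_eq_0[of _ N]) (auto simp: p_def c_def)
  ultimately show ?thesis by (rule that)
qed

text \<open>The derivatives have strictly decreasing degrees. In the coefficient at
  \<open>degree p - j\<close>, terms with index above \<open>j\<close> have too low a degree and
  those below \<open>j\<close> vanish by induction, which isolates \<open>c j\<close>.\<close>

lemma higher_pderiv_independent:
  fixes p :: "real poly"
  assumes "n \<le> degree p" "p \<noteq> 0" "(\<Sum>j\<le>n. smult (c j) ((pderiv ^^ j) p)) = 0" "j \<le> n"
  shows "c j = 0"
  using \<open>j \<le> n\<close>
proof (induction j rule: less_induct)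
  case (less j)
  let ?d = "degree p"
  have "0 = (\<Sum>i\<le>n. c i * coeff ((pderiv ^^ i) p) (?d - j))"
    using arg_cong[OF assms(3), of "\<lambda>p. coeff p (?d - j)"] by (simp add: coeff_sum)
  also have "\<dots> = (\<Sum>i\<in>{j}. c i * coeff ((pderiv ^^ i) p) (?d - j))"
  proof (rule sum.mono_neutral_right)
    show "\<forall>i\<in>{..n} - {j}. c i * coeff ((pderiv ^^ i) p) (?d - j) = 0"
    proof (rule ballI, elim DiffE, simp only: atMost_iff singleton_iff)
      fix i assume "i \<le> n" "i \<noteq> j"
      then consider "i < j" | "j < i" by linarith
      then show "c i * coeff ((pderiv ^^ i) p) (?d - j) = 0"
      proof cases
        case 1
        then show ?thesis using less by simp
      next
        case 2
        then show ?thesis using assms(1) less.prems \<open>i \<le> n\<close>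
          by (simp add: coeff_higher_pderiv coeff_eq_0)
      qed
    qed
  qed (use less.prems in auto)
  finally show ?case
    using assms(1,2) less.prems by (simp add: coeff_higher_pderiv pochhammer_eq_0_iff)
qed

section \<open>Trajectories parametrized by a scalar polynomial, and null steering\<close>

section \<open>Steering to the origin\<close>

text \<open>Classical solutions on the whole line suffice for sufficiency, where all inputs are
  built from polynomials. Two-sided derivatives avoid special cases at the ends of the
  interval.\<close>

definition control_path ::
  "real ^ 'n ^ 'n \<Rightarrow> real ^ 'p ^ 'n \<Rightarrow> (real \<Rightarrow> real ^ 'p) \<Rightarrow> (real \<Rightarrow> real ^ 'n) \<Rightarrow> bool" where
  "control_path A B w x \<longleftrightarrow> continuous_on UNIV w \<and>
     (\<forall>t. (x has_vector_derivative (A *v x t + B *v w t)) (at t))"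

lemma control_path_0: "control_path A B (\<lambda>_. 0) (\<lambda>_. 0)"
  by (simp add: control_path_def)

lemma control_path_add:
  assumes "control_path A B v x" "control_path A B w y"
  shows "control_path A B (\<lambda>t. v t + w t) (\<lambda>t. x t + y t)"
  unfolding control_path_def
proof (intro conjI allI)
  fix t
  have "((\<lambda>t. x t + y t) has_vector_derivative
      (A *v x t + B *v v t) + (A *v y t + B *v w t)) (at t)"
    using assms by (intro has_vector_derivative_add) (auto simp: control_path_def)
  then show "((\<lambda>t. x t + y t) has_vector_derivative
      A *v (x t + y t) + B *v (v t + w t)) (at t)"
    by (simp add: matrix_vector_right_distrib algebra_simps)
qed (use assms in \<open>auto simp: control_path_def intro: continuous_intros\<close>)

lemma control_path_scaleR:
  assumes "control_path A B v x"
  shows "control_path A B (\<lambda>t. c *\<^sub>R v t) (\<lambda>t. c *\<^sub>R x t)"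
  unfolding control_path_def
proof (intro conjI allI)
  fix t
  have "((\<lambda>t. c *\<^sub>R x t) has_vector_derivative c *\<^sub>R (A *v x t + B *v v t)) (at t)"
    using assms
    by (intro bounded_linear.has_vector_derivative[OF bounded_linear_scaleR_right])
      (auto simp: control_path_def)
  then show "((\<lambda>t. c *\<^sub>R x t) has_vector_derivative
      A *v (c *\<^sub>R x t) + B *v (c *\<^sub>R v t)) (at t)"
    by (simp add: linear_scale[OF matrix_vector_mul_linear] scaleR_add_right)
qed (use assms in \<open>auto simp: control_path_def intro: continuous_intros\<close>)

lemma has_vector_derivative_higher_pderiv:
  fixes p :: "real poly"
  shows "((\<lambda>t. poly ((pderiv ^^ j) p) t *\<^sub>R v) has_vector_derivative
     poly ((pderiv ^^ Suc j) p) t *\<^sub>R v) (at t)"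
  using has_vector_derivative_scaleR[OF poly_DERIV[of "(pderiv ^^ j) p" t] has_vector_derivative_const[of v "at t"]]
  by simp

text \<open>Here \<open>p\<close> is the scalar function \<open>psi\<close> and the
  \<open>f (Suc j)\<close> are the coefficients of \<open>E(s) b\<close>. Differentiating the state
  shifts the derivative order by one, and the chain relation turns the same shift into the action of
  \<open>A\<close> plus the input.\<close>

lemma flat_output_control_path:
  fixes A :: "real ^ 'n ^ 'n" and p :: "real poly"
  assumes f0: "f 0 = 0" and fn: "f n = B *v w" and qn: "q n = 1"
    and f: "\<And>j. j < n \<Longrightarrow> A *v f (Suc j) = f j - q j *\<^sub>R (B *v w)"
  shows "control_path A B (\<lambda>t. (\<Sum>j\<le>n. q j * poly ((pderiv ^^ j) p) t) *\<^sub>R w)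
    (\<lambda>t. \<Sum>j<n. poly ((pderiv ^^ j) p) t *\<^sub>R f (Suc j))"
  unfolding control_path_def
proof (intro conjI allI)
  fix t
  let ?d = "\<lambda>j. poly ((pderiv ^^ j) p) t"
  have "A *v (\<Sum>j<n. ?d j *\<^sub>R f (Suc j)) + B *v ((\<Sum>j\<le>n. q j * ?d j) *\<^sub>R w)
     = (\<Sum>j<n. ?d j *\<^sub>R (A *v f (Suc j))) + (\<Sum>j\<le>n. (q j * ?d j) *\<^sub>R (B *v w))"
    by (simp add: linear_sum[OF matrix_vector_mul_linear] linear_scale[OF matrix_vector_mul_linear]
        scaleR_sum_left)
  \<comment> \<open>The chain relation cancels the input terms with \<open>j < n\<close>; the
    leading one survives as \<open>f n\<close> because \<open>q n = 1\<close>.\<close>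
  also have "\<dots> = (\<Sum>j<n. ?d j *\<^sub>R f j) + ?d n *\<^sub>R f n"
    by (simp add: f fn qn lessThan_Suc_atMost[symmetric] scaleR_diff_right sum_subtractf mult.commute)
  also have "\<dots> = (\<Sum>j<Suc n. ?d j *\<^sub>R f j)" by simp
  also have "\<dots> = (\<Sum>j<n. ?d (Suc j) *\<^sub>R f (Suc j))"
    by (subst sum.lessThan_Suc_shift) (simp add: f0)
  finally show "((\<lambda>t. \<Sum>j<n. poly ((pderiv ^^ j) p) t *\<^sub>R f (Suc j)) has_vector_derivative
      A *v (\<Sum>j<n. ?d j *\<^sub>R f (Suc j)) + B *v ((\<Sum>j\<le>n. q j * ?d j) *\<^sub>R w)) (at t)"
    by (simp only:) (intro has_vector_derivative_sum has_vector_derivative_higher_pderiv)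
qed (intro continuous_intros)

text \<open>Since \<open>b = f n\<close> is itself in the chain, the relation makes the span
  invariant under \<open>A\<close>. Claims about all iterates of \<open>b\<close> thus reduce to
  finitely many chain vectors.\<close>

lemma funpow_in_span_chain:
  fixes A :: "real ^ 'n ^ 'n"
  assumes f0: "f 0 = 0" and fn: "f n = b"
    and f: "\<And>j. j < n \<Longrightarrow> A *v f (Suc j) = f j - q j *\<^sub>R b"
  shows "((*v) A ^^ k) b \<in> span (f ` {..n})"
proof -
  let ?S = "span (f ` {..n})"
  have fS: "f j \<in> ?S" if "j \<le> n" for j using that by (intro span_base) auto
  have "A *v f j \<in> ?S" if "j \<le> n" for j
  proof (cases j)
    case 0
    then show ?thesis using f0 by (simp add: span_zero)
  next
    case (Suc i)
    then show ?thesis using that fS[of n] fS[of i] fn f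
      by (auto intro: span_diff span_scale)
  qed
  then have "(*v) A ` ?S \<subseteq> ?S"
    unfolding linear_span_image[OF matrix_vector_mul_linear, symmetric]
    by (intro span_minimal) auto
  then show ?thesis
    using fS[of n] fn by (induction k) auto
qed

lemma controllable_subspace_null_steering:
  fixes A :: "real ^ 'n ^ 'n"
  assumes "x0 \<in> controllable_subspace A B" "T \<noteq> 0"
  obtains w x where "control_path A B w x" "x 0 = x0" "x T = 0"
proof -
  define V where "V = {x0. \<exists>w x. control_path A B w x \<and> x 0 = x0 \<and> x T = 0}"
  have VI: "x 0 \<in> V" if "control_path A B w x" "x T = 0" for w x
    using that by (auto simp: V_def)
  have sub: "subspace V"
  proof (rule subspaceI)
    show "0 \<in> V" using VI[OF control_path_0] by simp
  next
    fix a b assume "a \<in> V" "b \<in> V"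
    then obtain v x w y where "control_path A B v x" "x 0 = a" "x T = 0"
        "control_path A B w y" "y 0 = b" "y T = 0" by (auto simp: V_def)
    then show "a + b \<in> V" using VI[OF control_path_add, of v x w y] by simp
  next
    fix c a assume "a \<in> V"
    then obtain v x where "control_path A B v x" "x 0 = a" "x T = 0" by (auto simp: V_def)
    then show "c *\<^sub>R a \<in> V" using VI[OF control_path_scaleR, of v x c] by simp
  qed
  have "((*v) A ^^ k) (B *v w) \<in> V" for w k
  proof -
    let ?n = "CARD('n)"
    obtain f q where f: "f 0 = 0" "f ?n = B *v w" "q ?n = 1"
      "\<And>j. j < ?n \<Longrightarrow> A *v f (Suc j) = f j - q j *\<^sub>R (B *v w)"
      using krylov_chain by blast
    \<comment> \<open>The state depends only on the derivatives of \<open>p\<close> of order below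
      n: selecting the \<open>m\<close>-th at 0 makes the initial state \<open>f (Suc m)\<close>,
      and zero jets at \<open>T\<close> make the final state 0.\<close>
    have fV: "f (Suc m) \<in> V" if m: "m < ?n" for m
    proof -
      obtain p where p: "\<And>j. j < ?n \<Longrightarrow> poly ((pderiv ^^ j) p) 0 = (if j = m then 1 else 0)"
        "\<And>j. j < ?n \<Longrightarrow> poly ((pderiv ^^ j) p) T = 0"
        using hermite_interpolation[OF \<open>T \<noteq> 0\<close> m] by blast
      from VI[OF flat_output_control_path[where p = p and f = f and q = q, OF f]] show ?thesis
        using m by (simp add: p if_distrib[of "\<lambda>a. a *\<^sub>R _"] cong: if_cong)
    qed
    have "f j \<in> V" if "j \<le> ?n" for j
      using that fV f(1) subspace_0[OF sub] by (cases j) auto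
    then have "span (f ` {..?n}) \<subseteq> V"
      by (intro span_minimal sub) auto
    then show ?thesis using funpow_in_span_chain[OF f(1,2,4)] by blast
  qed
  from controllable_subspace_subset[OF sub this] assms(1) have "x0 \<in> V" by blast
  then show ?thesis using that by (auto simp: V_def)
qed

section \<open>Vanishing Markov parameters, and a loop that is visible in the output\<close>

section \<open>Loops with nonzero uncertainty output\<close>

lemma map_matrix_of_real_mult:
  "map_matrix of_real (X ** Y) = (map_matrix of_real X ** map_matrix of_real Y :: complex ^ 'a ^ 'b)"
  by (simp add: map_matrix_def matrix_matrix_mult_def vec_eq_iff)

lemma matrix_inv_left: "matrix_inv M ** M = mat 1" if "invertible M"
  using someI_ex[OF that[unfolded invertible_def]] unfolding matrix_inv_def by blast

(* The largest A-invariant subspace K of the kernel of C is mapped into itself, hence onto itself,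
   by the injective map s - A; so the resolvent maps the range of B, which lies in K, into K. *)
lemma transfer_function_eq_0:
  fixes A :: "real ^ 'n ^ 'n" and B :: "real ^ 'm ^ 'n" and C :: "real ^ 'n ^ 'h"
  assumes D: "\<And>w. D *v w = 0" and C: "\<And>k w. C *v ((*v) A ^^ k) (B *v w) = 0"
    and s: "invertible (mat s - map_matrix of_real A :: complex ^ 'n ^ 'n)"
  shows "transfer_function A B C D s = 0"
proof -
  let ?A = "map_matrix of_real A :: complex ^ 'n ^ 'n"
  let ?B = "map_matrix of_real B :: complex ^ 'm ^ 'n"
  let ?C = "map_matrix of_real C :: complex ^ 'n ^ 'h"
  let ?R = "mat s - ?A"
  define K where "K = {v. \<forall>k. ?C *v ((*v) ?A ^^ k) v = 0}"
  have D0: "D = 0" using D by (simp add: matrix_eq)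
  have lin: "linear ((*v) ?A ^^ k)" for k
  proof (induction k)
    case 0
    show ?case using linear_id by (simp add: id_def)
  next
    case (Suc k)
    then show ?case using linear_compose[OF Suc matrix_vector_mul_linear, of ?A] by (simp add: o_def)
  qed
  have lin_C: "linear (\<lambda>v. ?C *v ((*v) ?A ^^ k) v)" for k
    using linear_compose[OF lin[of k] matrix_vector_mul_linear[of ?C]] by (simp add: o_def)
  \<comment> \<open>\<open>subspace\<close>, \<open>linear\<close> and \<open>dim\<close> refer to
    the real structure of \<open>complex ^ 'n\<close>, which suffices for the dimension count.
    Compatibility with the complex scalar \<open>s\<close> is therefore shown separately in
    \<open>scale\<close>.\<close>
  have sub: "subspace K"
    unfolding K_def by (auto intro!: subspaceI simp: linear_add[OF lin_C] linear_scale[OF lin_C] linear_0[OF lin_C])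
  have scale: "((*v) ?A ^^ k) (s *s v) = s *s ((*v) ?A ^^ k) v" for k v
    by (induction k) (simp_all add: vector_scalar_commute)
  have R: "?R *v v = s *s v - ?A *v v" for v
    by (simp add: left_diff_distrib sum_subtractf vec_eq_iff matrix_vector_mult_def mat_def
        if_distrib[of "\<lambda>a. a * _"] cong: if_cong)
  have "?R *v v \<in> K" if "v \<in> K" for v
  proof -
    have "((*v) ?A ^^ k) (?R *v v) = s *s ((*v) ?A ^^ k) v - ((*v) ?A ^^ Suc k) v" for k
      unfolding R linear_diff[OF lin] scale by (simp only: funpow_Suc_right o_apply)
    then have "?C *v ((*v) ?A ^^ k) (?R *v v) = s *s (?C *v ((*v) ?A ^^ k) v) - ?C *v ((*v) ?A ^^ Suc k) v" for k
      by (simp only: matrix_vector_mult_diff_distrib vector_scalar_commute)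
    moreover have v: "?C *v ((*v) ?A ^^ k) v = 0" for k using that by (simp add: K_def)
    ultimately have "?C *v ((*v) ?A ^^ k) (?R *v v) = 0" for k by (simp only: v) simp
    then show ?thesis unfolding K_def by blast
  qed
  then have "(*v) ?R ` K \<subseteq> K" by blast
  moreover have "inj ((*v) ?R)"
    using s by (simp add: invertible_left_inverse matrix_left_invertible_injective)
  then have "dim ((*v) ?R ` K) = dim K"
    by (intro dim_image_eq matrix_vector_mul_linear) (auto intro: inj_on_subset)
  ultimately have RK: "(*v) ?R ` K = K"
    using sub by (intro subspace_dim_equal linear_subspace_image matrix_vector_mul_linear) auto
  have "(?C ** matrix_inv ?R ** ?B) *v w = 0" for w
  proof -
    have "((*v) ?A ^^ k) (?B *v w) = map_matrix of_real (matrix_power A k ** B) *v w" for k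
      unfolding matrix_power_def
      by (induction k) (simp_all add: map_matrix_of_real_mult matrix_vector_mul_assoc matrix_mul_assoc)
    \<comment> \<open>The Markov parameters vanish as real matrices, hence also as complex ones;
      this puts the range of \<open>?B\<close> into \<open>K\<close>.\<close>
    moreover have "C ** (matrix_power A k ** B) = 0" for k
      using C by (simp add: matrix_eq matrix_vector_mul_assoc[symmetric] matrix_power_mult_vec)
    then have "?C ** map_matrix of_real (matrix_power A k ** B) = (0 :: complex ^ 'm ^ 'h)" for k
      by (simp add: map_matrix_of_real_mult[symmetric]) (simp add: map_matrix_def vec_eq_iff)
    ultimately have "?B *v w \<in> K"
      by (simp add: K_def matrix_vector_mul_assoc)
    then obtain v where v: "v \<in> K" "?B *v w = ?R *v v" using RK by blast
    have "(?C ** matrix_inv ?R ** ?B) *v w = ?C *v (matrix_inv ?R *v (?R *v v))"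
      by (simp add: matrix_vector_mul_assoc[symmetric] v(2))
    also have "\<dots> = ?C *v v"
      using matrix_inv_left[OF s] by (simp add: matrix_vector_mul_assoc)
    also have "\<dots> = 0" using v(1) unfolding K_def by (auto dest: spec[of _ 0])
    finally show ?thesis .
  qed
  then have "?C ** matrix_inv ?R ** ?B = 0" by (simp add: matrix_eq)
  then show ?thesis by (simp add: transfer_function_def D0) (simp add: map_matrix_def vec_eq_iff)
qed

text \<open>If every loop had zero output, then for each \<open>w\<close> a combination of
  derivatives of one fixed polynomial would vanish on an interval. Independence kills its
  coefficients, so \<open>D\<close> and all \<open>C A^k B\<close> vanish, and with them the
  transfer function.\<close>

lemma null_loop_nonzero_output:
  fixes A :: "real ^ 'n ^ 'n" and B :: "real ^ 'm ^ 'n" and C :: "real ^ 'n ^ 'h"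
  assumes H: "transfer_function_nonzero A B C D" and T: "0 < T"
  obtains v x t where "control_path A B v x" "x 0 = 0" "x T = 0" "t \<in> {0..T}"
    "C *v x t + D *v v t \<noteq> 0"
proof -
  have False if *: "\<And>v x. control_path A B v x \<Longrightarrow> x 0 = 0 \<Longrightarrow> x T = 0 \<Longrightarrow>
      \<forall>t\<in>{0..T}. C *v x t + D *v v t = 0"
  proof -
    let ?n = "CARD('n)"
    define N where "N = Suc ?n"
    \<comment> \<open>The zeros of order \<open>N\<close> at both ends close the loop, and the
      degree \<open>2 N\<close> is large enough for the independence lemma.\<close>
    define p :: "real poly" where "p = [:-0, 1:] ^ N * [:-T, 1:] ^ N"
    have p0: "poly ((pderiv ^^ j) p) 0 = 0" and pT: "poly ((pderiv ^^ j) p) T = 0"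
      if "j < N" for j
      using that by (auto intro!: poly_higher_pderiv_eq_0[of _ N] simp: p_def)
    have pn0: "p \<noteq> 0" by (simp only: p_def mult_eq_0_iff power_eq_0_iff) simp
    have "degree p = N + N"
      unfolding p_def by (subst degree_mult_eq) (simp_all add: degree_power_eq)
    then have deg: "?n \<le> degree p" by (simp add: N_def)
    have key: "D *v w = 0 \<and> (\<forall>k. C *v ((*v) A ^^ k) (B *v w) = 0)" for w
    proof -
      obtain f q where f: "f 0 = 0" "f ?n = B *v w" "q ?n = 1"
        "\<And>j. j < ?n \<Longrightarrow> A *v f (Suc j) = f j - q j *\<^sub>R (B *v w)"
        using krylov_chain by blast
      \<comment> \<open>The coefficient of the \<open>j\<close>-th derivative of \<open>p\<close> in
        the output. The state involves orders below n only, so at \<open>j = n\<close> just the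
        feedthrough term is left.\<close>
      define M where "M j = (if j < ?n then C *v f (Suc j) else 0) + q j *\<^sub>R (D *v w)" for j
      let ?d = "\<lambda>j t. poly ((pderiv ^^ j) p) t"
      have zero: "(\<Sum>j\<le>?n. ?d j t *\<^sub>R M j) = 0" if "t \<in> {0..T}" for t
      proof -
        have "C *v (\<Sum>j<?n. ?d j t *\<^sub>R f (Suc j)) + D *v ((\<Sum>j\<le>?n. q j * ?d j t) *\<^sub>R w) = 0"
          using *[OF flat_output_control_path[where p = p and f = f and q = q, OF f]] that
          by (simp add: p0 pT N_def)
        then have "(\<Sum>j<?n. ?d j t *\<^sub>R (C *v f (Suc j))) + (\<Sum>j\<le>?n. (q j * ?d j t) *\<^sub>R (D *v w)) = 0"
          by (simp add: linear_sum[OF matrix_vector_mul_linear] linear_scale[OF matrix_vector_mul_linear]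
              scaleR_sum_left)
        then show ?thesis
          by (simp add: M_def lessThan_Suc_atMost[symmetric] scaleR_add_right sum.distrib mult.commute algebra_simps)
      qed
      have zero_poly: "(\<Sum>j\<le>?n. smult (M j $ i) ((pderiv ^^ j) p)) = 0" for i
      proof (rule ccontr)
        let ?p = "\<Sum>j\<le>?n. smult (M j $ i) ((pderiv ^^ j) p)"
        assume "?p \<noteq> 0"
        then have "finite {t. poly ?p t = 0}" by (rule poly_roots_finite)
        moreover have "{0..T} \<subseteq> {t. poly ?p t = 0}"
        proof clarsimp
          fix t assume "0 \<le> t" "t \<le> T"
          with zero[of t]
          have "(\<Sum>j\<le>?n. ?d j t *\<^sub>R M j) $ i = 0" by simp
          then show "poly ?p t = 0" by (simp add: poly_sum mult.commute)
        qed
        ultimately have "finite {0..T}" by (rule rev_finite_subset)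
        then show False using infinite_Icc[OF T] by contradiction
      qed
      have M0: "M j = 0" if "j \<le> ?n" for j
        using higher_pderiv_independent[OF deg pn0 zero_poly that]
        by (auto simp: vec_eq_iff)
      \<comment> \<open>The top coefficient is \<open>D w\<close> itself as \<open>q n = 1\<close>;
        once it is gone, the lower ones reduce to \<open>C f (Suc j)\<close>.\<close>
      have Dw: "D *v w = 0" using M0[of ?n] f(3) by (simp add: M_def)
      have "C *v f j = 0" if "j \<le> ?n" for j
        using that M0[of "j - 1"] f(1) Dw by (cases j) (auto simp: M_def)
      then have "span (f ` {..?n}) \<subseteq> {v. C *v v = 0}"
        by (intro span_minimal)
          (auto intro!: subspaceI simp: matrix_vector_right_distrib linear_scale[OF matrix_vector_mul_linear])
      then show ?thesis using funpow_in_span_chain[OF f(1,2,4)] Dw by blast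
    qed
    from H show False
      unfolding transfer_function_nonzero_def using transfer_function_eq_0[of D C A B] key by blast
  qed
  then show ?thesis using that by blast
qed

section \<open>A single trajectory that serves every d and every \<epsilon>\<close>

section \<open>Sufficiency\<close>

lemma continuous_on_matrix_vector_mult [continuous_intros]:
  fixes M :: "real ^ 'a ^ 'b"
  assumes "continuous_on S f"
  shows "continuous_on S (\<lambda>t. M *v f t)"
  by (rule bounded_linear.continuous_on[OF matrix_vector_mul_bounded_linear assms])

lemma square_integrable_on_continuous:
  assumes "continuous_on {0..T} f"
  shows "square_integrable_on f T"
  unfolding square_integrable_on_def
proof
  show "f \<in> borel_measurable (lebesgue_on {0..T})"
    using assms by (intro continuous_imp_measurable_on_sets_lebesgue) auto
  show "integrable (lebesgue_on {0..T}) (\<lambda>t. (norm (f t))\<^sup>2)"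
    using assms by (intro continuous_imp_integrable_real continuous_intros)
qed

lemma block_row_mult:
  fixes B1 :: "real ^ 'm ^ 'n" and B2 :: "real ^ 'r ^ 'n"
  shows "block_row B1 B2 *v w = B1 *v (\<chi> i. w $ Inl i) + B2 *v (\<chi> i. w $ Inr i)"
  by (simp add: vec_eq_iff matrix_vector_mult_def block_row_def UNIV_Plus_UNIV[symmetric] sum.Plus
      del: UNIV_Plus_UNIV)

lemma integral_norm_power2_pos:
  fixes f :: "real \<Rightarrow> 'a::real_normed_vector"
  assumes "continuous_on {0..T} f" "t \<in> {0..T}" "f t \<noteq> 0" "0 < T"
  shows "0 < (LINT t|lebesgue_on {0..T}. (norm (f t))\<^sup>2)"
proof -
  let ?g = "\<lambda>t. (norm (f t))\<^sup>2"
  have g: "continuous_on {0..T} ?g" using assms(1) by (intro continuous_intros)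
  have "(LINT t|lebesgue_on {0..T}. ?g t) \<noteq> 0"
    using integralL_eq_0_iff[OF g] assms(2-4) by auto
  then show ?thesis by (simp add: less_le)
qed

text \<open>The loop enters through \<open>B1\<close> alone, so scaling it by \<open>a\<close>
  changes the control and the uncertainty output but leaves the uncertainty input fixed.\<close>

lemma control_path_trajectory:
  fixes B1 :: "real ^ 'm ^ 'n" and B2 :: "real ^ 'r ^ 'n"
  assumes w: "control_path A (block_row B1 B2) w x" and v: "control_path A B1 v y"
  shows "trajectory A B1 B2 C1 D1 C2 D2 T
     (\<lambda>t. (\<chi> i. w t $ Inl i) + a *\<^sub>R v t) (\<lambda>t. \<chi> i. w t $ Inr i) (\<lambda>t. x t + a *\<^sub>R y t)
     (\<lambda>t. (C1 *v x t + D1 *v (\<chi> i. w t $ Inl i)) + a *\<^sub>R (C1 *v y t + D1 *v v t))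
     (\<lambda>t. C2 *v (x t + a *\<^sub>R y t) + D2 *v (\<chi> i. w t $ Inr i))"
proof -
  have cw: "continuous_on S w" and cv: "continuous_on S v" for S
    using w v by (auto simp: control_path_def intro: continuous_on_subset)
  have "((\<lambda>s. A *v (x s + a *\<^sub>R y s) + B1 *v ((\<chi> i. w s $ Inl i) + a *\<^sub>R v s) + B2 *v (\<chi> i. w s $ Inr i))
      has_integral (x t + a *\<^sub>R y t - (x 0 + a *\<^sub>R y 0))) {0..t}" if "0 \<le> t" for t
  proof (rule fundamental_theorem_of_calculus[OF that])
    fix s
    have "((\<lambda>t. x t + a *\<^sub>R y t) has_vector_derivative
       (A *v x s + block_row B1 B2 *v w s) + a *\<^sub>R (A *v y s + B1 *v v s)) (at s)"
      using w v
      by (intro has_vector_derivative_add bounded_linear.has_vector_derivative[OF bounded_linear_scaleR_right])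
        (auto simp: control_path_def)
    then have "((\<lambda>t. x t + a *\<^sub>R y t) has_vector_derivative
        A *v (x s + a *\<^sub>R y s) + B1 *v ((\<chi> i. w s $ Inl i) + a *\<^sub>R v s) + B2 *v (\<chi> i. w s $ Inr i)) (at s)"
      by (simp add: block_row_mult matrix_vector_right_distrib linear_scale[OF matrix_vector_mul_linear]
          algebra_simps)
    then show "((\<lambda>t. x t + a *\<^sub>R y t) has_vector_derivative
        A *v (x s + a *\<^sub>R y s) + B1 *v ((\<chi> i. w s $ Inl i) + a *\<^sub>R v s) + B2 *v (\<chi> i. w s $ Inr i))
        (at s within {0..t})"
      by (rule has_vector_derivative_at_within)
  qed
  moreover have "square_integrable_on (\<lambda>t. (\<chi> i. w t $ Inl i) + a *\<^sub>R v t) T"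
    "square_integrable_on (\<lambda>t. \<chi> i. w t $ Inr i) T"
    by (intro square_integrable_on_continuous continuous_intros cw cv)+
  ultimately show ?thesis
    unfolding trajectory_def
    by (simp add: matrix_vector_right_distrib linear_scale[OF matrix_vector_mul_linear] algebra_simps)
qed

lemma possibly_controllable_on_if_controllable_state:
  fixes A :: "real ^ 'n ^ 'n" and B1 :: "real ^ 'm ^ 'n" and B2 :: "real ^ 'r ^ 'n"
    and C1 :: "real ^ 'n ^ 'h" and D1 :: "real ^ 'm ^ 'h"
    and C2 :: "real ^ 'n ^ 'l" and D2 :: "real ^ 'r ^ 'l"
  assumes H: "transfer_function_nonzero A B1 C1 D1" and "x0 \<noteq> 0"
    and x0: "controllable_state A (block_row B1 B2) x0" and T: "0 < T"
  shows "possibly_controllable_on A B1 B2 C1 D1 C2 D2 x0 T"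
proof -
  obtain w x where w: "control_path A (block_row B1 B2) w x" "x 0 = x0" "x T = 0"
    using x0 T controllable_subspace_null_steering[of x0 A "block_row B1 B2" T]
    unfolding controllable_state_def by auto
  obtain v y t where v: "control_path A B1 v y" "y 0 = 0" "y T = 0"
    and t: "t \<in> {0..T}" "C1 *v y t + D1 *v v t \<noteq> 0"
    using null_loop_nonzero_output[OF H T] by blast
  let ?L = "lebesgue_on {0..T}"
  define \<xi> where "\<xi> t = (\<chi> i. w t $ Inr i)" for t
  define z0 where "z0 t = C1 *v x t + D1 *v (\<chi> i. w t $ Inl i)" for t
  define z1 where "z1 t = C1 *v y t + D1 *v v t" for t
  have cont: "continuous_on S f" if "control_path A B u f" for S f u and B :: "real ^ 'p ^ 'n"
    using that unfolding control_path_def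
    by (meson continuous_at_imp_continuous_on has_vector_derivative_continuous)
  have cw: "continuous_on S w" and cv: "continuous_on S v" for S
    using w v by (auto simp: control_path_def intro: continuous_on_subset)
  have cont_z0: "continuous_on {0..T} z0" and cont_z1: "continuous_on {0..T} z1"
    and cont_\<xi>: "continuous_on {0..T} \<xi>"
    unfolding z0_def z1_def \<xi>_def by (intro continuous_intros cw cv cont[OF w(1)] cont[OF v(1)])+
  have int: "integrable ?L (\<lambda>t. (norm (f t))\<^sup>2)" if "continuous_on {0..T} f"
    for f :: "real \<Rightarrow> 'b::real_normed_vector"
    using that by (intro continuous_imp_integrable_real continuous_intros)
  define E where "E = (LINT t|?L. (norm (\<xi> t))\<^sup>2)"
  define I0 where "I0 = (LINT t|?L. (norm (z0 t))\<^sup>2)"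
  define I1 where "I1 = (LINT t|?L. (norm (z1 t))\<^sup>2)"
  have I1: "0 < I1"
    unfolding I1_def using t T cont_z1 by (intro integral_norm_power2_pos) (auto simp: z1_def)
  have nonneg: "0 \<le> E" "0 \<le> I0" by (simp_all add: E_def I0_def)
  \<comment> \<open>Chosen so that the lower bound \<open>a\<^sup>2 * I1 / 2 - I0\<close> for the
    output energy equals the input energy \<open>E\<close>.\<close>
  define a where "a = sqrt (2 * (E + I0) / I1)"
  have a: "a\<^sup>2 * I1 / 2 = E + I0"
    using I1 nonneg by (simp add: a_def)
  have "a\<^sup>2 * I1 / 2 - I0 = (LINT t|?L. a\<^sup>2 / 2 * (norm (z1 t))\<^sup>2 - (norm (z0 t))\<^sup>2)"
    using int[OF cont_z0] int[OF cont_z1] by (simp add: I0_def I1_def)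
  also have "\<dots> \<le> (LINT t|?L. (norm (z0 t + a *\<^sub>R z1 t))\<^sup>2)"
  proof (intro integral_mono Bochner_Integration.integrable_diff integrable_mult_right)
    fix t
    \<comment> \<open>Pointwise form of the bound, from the triangle inequality and
      \<open>(r + s)\<^sup>2 \<le> 2 * r\<^sup>2 + 2 * s\<^sup>2\<close>.\<close>
    have "norm (a *\<^sub>R z1 t) \<le> norm (z0 t + a *\<^sub>R z1 t) + norm (z0 t)"
      by (metis add_diff_cancel_left' norm_triangle_ineq4)
    then have "(norm (a *\<^sub>R z1 t))\<^sup>2 \<le> (norm (z0 t + a *\<^sub>R z1 t) + norm (z0 t))\<^sup>2"
      by (intro power_mono) auto
    also have "\<dots> \<le> 2 * (norm (z0 t + a *\<^sub>R z1 t))\<^sup>2 + 2 * (norm (z0 t))\<^sup>2"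
      using zero_le_power2[of "norm (z0 t + a *\<^sub>R z1 t) - norm (z0 t)"]
      by (simp add: power2_eq_square algebra_simps)
    finally show "a\<^sup>2 / 2 * (norm (z1 t))\<^sup>2 - (norm (z0 t))\<^sup>2 \<le> (norm (z0 t + a *\<^sub>R z1 t))\<^sup>2"
      by (simp add: power_mult_distrib)
  qed (intro int cont_z0 cont_z1 continuous_intros)+
  finally have "E \<le> (LINT t|?L. (norm (z0 t + a *\<^sub>R z1 t))\<^sup>2)"
    using a by simp
  then have iqc: "(LINT t|?L. (norm (\<xi> t))\<^sup>2 - (norm (z0 t + a *\<^sub>R z1 t))\<^sup>2) \<le> 0"
    by (subst Bochner_Integration.integral_diff)
      (auto simp: E_def intro!: int cont_\<xi> cont_z0 cont_z1 continuous_intros)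
  define u where "u t = (\<chi> i. w t $ Inl i) + a *\<^sub>R v t" for t
  define M where "M = (LINT t|?L. (norm (u t))\<^sup>2)"
  \<comment> \<open>The sequence of length one is admissible for all positive \<open>d\<close> by
    \<open>iqc\<close>. Its final state is 0, so the term divided by \<epsilon> disappears and only
    \<open>M\<close> remains.\<close>
  have "possible_controllability_function A B1 B2 C1 D1 C2 D2 d x0 T \<le> ereal M" if "0 < d" for d
    unfolding possible_controllability_function_def
  proof (intro SUP_least Inf_lower CollectI exI conjI)
    fix \<epsilon> :: real
    show "ereal M = ereal (averaged_cost \<epsilon> T 1 (\<lambda>_. u) (\<lambda>_ t. x t + a *\<^sub>R y t))"
      using w v by (simp add: averaged_cost_def M_def)
    show "admissible A B1 B2 C1 D1 C2 D2 d x0 T 1 (\<lambda>_. u) (\<lambda>_. \<xi>) (\<lambda>_ t. x t + a *\<^sub>R y t)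
       (\<lambda>_ t. z0 t + a *\<^sub>R z1 t) (\<lambda>_ t. C2 *v (x t + a *\<^sub>R y t) + D2 *v \<xi> t)"
      using control_path_trajectory[OF w(1) v(1), of C1 D1 C2 D2 T a] iqc that w(2) v(2)
      unfolding admissible_def u_def \<xi>_def z0_def z1_def by simp
  qed simp
  then have "(SUP d\<in>{0<..}. possible_controllability_function A B1 B2 C1 D1 C2 D2 d x0 T) \<le> ereal M"
    by (intro SUP_least) auto
  then show ?thesis
    using \<open>x0 \<noteq> 0\<close> unfolding possibly_controllable_on_def by (auto intro: le_less_trans)
qed

section \<open>A lower bound on the final state, uniform over all inputs\<close>

section \<open>Necessity\<close>

text \<open>A Gronwall-type bound for short intervals. From a point \<open>t\<close> where the norm
  is maximal, \<open>p\<close> moves by at most \<open>K * T * norm (p t)\<close>, which is half of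
  that maximum, so at least half of it is left at \<open>T\<close>.\<close>

lemma norm_initial_le_norm_final:
  fixes p :: "real \<Rightarrow> 'a::euclidean_space"
  assumes p: "\<And>t. t \<in> {0..T} \<Longrightarrow> ((\<lambda>s. M (p s)) has_integral (p t - p 0)) {0..t}"
    and M: "\<And>v. norm (M v) \<le> K * norm v" and "0 \<le> K" and T: "0 \<le> T" "K * T \<le> 1 / 2"
  shows "norm (p 0) \<le> 2 * norm (p T)"
proof -
  let ?g = "\<lambda>s. M (p s)"
  have int: "?g integrable_on {0..T}" using p[of T] T by auto
  \<comment> \<open>Continuity of \<open>p\<close> is read off from the integral equation; it is
    needed for the maximum to be attained.\<close>
  have "continuous_on {0..T} (\<lambda>t. norm (p 0 + integral {0..t} ?g))"
    by (intro continuous_intros indefinite_integral_continuous_1 int)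
  then have "continuous_on {0..T} (\<lambda>t. norm (p t))"
    by (rule continuous_on_eq) (simp add: integral_unique[OF p])
  then obtain t where t: "t \<in> {0..T}" and max: "\<And>s. s \<in> {0..T} \<Longrightarrow> norm (p s) \<le> norm (p t)"
    using continuous_attains_sup[of "{0..T}" "\<lambda>t. norm (p t)"] T by auto
  have intT: "?g integrable_on {t..T}"
    using t by (intro integrable_on_subinterval[OF int]) auto
  have "(?g has_integral (p t - p 0 + integral {t..T} ?g)) {0..T}"
    using t by (intro has_integral_combine[OF _ _ p integrable_integral[OF intT]]) auto
  then have "p T - p 0 = p t - p 0 + integral {t..T} ?g"
    using p[of T] T by (intro has_integral_unique[of ?g _ "{0..T}"]) auto
  then have eq: "p T - p t = integral {t..T} ?g" by (simp add: algebra_simps)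
  have bd: "norm (M (p s)) \<le> K * norm (p t)" if "s \<in> {t..T}" for s
    using M[of "p s"] mult_left_mono[OF max[of s] \<open>0 \<le> K\<close>] that t by auto
  have "norm (integral {t..T} ?g) \<le> K * norm (p t) * (T - t)"
    using has_integral_bound[of "K * norm (p t)" ?g "integral {t..T} ?g" t T] bd intT \<open>0 \<le> K\<close> t
    by (simp add: integrable_integral)
  also have "\<dots> \<le> K * norm (p t) * T"
    using t \<open>0 \<le> K\<close> by (intro mult_left_mono) auto
  also have "\<dots> \<le> norm (p t) / 2"
    using mult_right_mono[OF T(2) norm_ge_zero[of "p t"]] by (simp add: mult_ac)
  finally have "norm (p T - p t) \<le> norm (p t) / 2" by (simp add: eq)
  then have "norm (p t) \<le> 2 * norm (p T)"
    using norm_triangle_ineq2[of "p t" "p T"] by (simp add: norm_minus_commute)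
  moreover have "norm (p 0) \<le> norm (p t)" using max T by auto
  ultimately show ?thesis by linarith
qed

text \<open>\<open>P\<close> subtracts the components along an orthogonal spanning set of
  \<open>R\<close>. A vector of \<open>R\<close> is sent to one that lies in \<open>R\<close> and is
  orthogonal to \<open>R\<close>, hence to 0.\<close>

lemma linear_projection_along_subspace:
  fixes R :: "'a::euclidean_space set"
  assumes "subspace R"
  obtains P :: "'a \<Rightarrow> 'a" where "linear P" "\<And>v. v - P v \<in> R" "\<And>v. v \<in> R \<Longrightarrow> P v = 0"
proof -
  obtain B where B: "B \<subseteq> R" "pairwise orthogonal B" "span B = R"
    using orthogonal_spanningset_subspace[OF assms] by blast
  define P where "P v = v - (\<Sum>b\<in>B. (b \<bullet> v / (b \<bullet> b)) *\<^sub>R b)" for v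
  have "linear P"
    unfolding P_def
    by (rule linearI)
      (simp_all add: inner_add_right add_divide_distrib scaleR_add_left sum.distrib
        scaleR_diff_right scaleR_sum_right)
  moreover have R: "v - P v \<in> R" for v
    using assms B(1) by (auto simp: P_def intro!: subspace_sum subspace_scale)
  moreover have "P v = 0" if "v \<in> R" for v
  proof -
    have "P v \<in> R" using subspace_diff[OF assms that R[of v]] by simp
    then have "orthogonal (P v) (P v)"
      unfolding P_def[of v] using Gram_Schmidt_step[OF B(2), of _ v] B(3) by (simp add: P_def)
    then show ?thesis by (simp add: orthogonal_self)
  qed
  ultimately show ?thesis by (rule that)
qed

lemma uncontrollable_part_persists:
  fixes A :: "real ^ 'n ^ 'n" and B1 :: "real ^ 'm ^ 'n" and B2 :: "real ^ 'r ^ 'n"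
  assumes "\<not> controllable_state A (block_row B1 B2) x0"
  obtains \<delta> c where "0 < \<delta>" "0 < c"
    "\<And>T (C1 :: real ^ 'n ^ 'h) D1 (C2 :: real ^ 'n ^ 'l) D2 u \<xi> x z y. 0 < T \<Longrightarrow> T < \<delta> \<Longrightarrow>
       trajectory A B1 B2 C1 D1 C2 D2 T u \<xi> x z y \<Longrightarrow> x 0 = x0 \<Longrightarrow> c \<le> norm (x T)"
proof -
  let ?R = "controllable_subspace A (block_row B1 B2)"
  obtain P where P: "linear P" "\<And>v. v - P v \<in> ?R" "\<And>v. v \<in> ?R \<Longrightarrow> P v = 0"
    using linear_projection_along_subspace[OF subspace_controllable_subspace] by blast
  have "P x0 \<noteq> 0"
    using assms P(2)[of x0] by (auto simp: controllable_state_def)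
  have bl: "bounded_linear P" using P(1) by (simp add: linear_conv_bounded_linear)
  have blM: "bounded_linear (\<lambda>v. P (A *v v))"
    using bounded_linear_compose[OF bl matrix_vector_mul_bounded_linear[of A]] .
  obtain K where K: "0 < K" "\<And>v. norm (P (A *v v)) \<le> K * norm v"
    using bounded_linear.pos_bounded[OF blM] by (auto simp: mult.commute)
  obtain L where L: "0 < L" "\<And>v. norm (P v) \<le> L * norm v"
    using bounded_linear.pos_bounded[OF bl] by (auto simp: mult.commute)
  have range: "block_row B1 B2 *v w \<in> ?R" for w
    using funpow_in_controllable_subspace[of 0] by simp
  have "B1 *v u + B2 *v v \<in> ?R" for u v
    using range[of "\<chi> i. case i of Inl a \<Rightarrow> u $ a | Inr b \<Rightarrow> v $ b"] by (simp add: block_row_mult)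
  then have PB: "P (A *v v + B1 *v a + B2 *v b) = P (A *v v)" for v a b
    using P(3) linear_add[OF P(1)] by (metis add.assoc add.right_neutral)
  \<comment> \<open>\<open>v - P v\<close> is controllable, \<open>A\<close> keeps it controllable,
    and \<open>P\<close> annihilates the result; this closes the equation for
    \<open>P x\<close>.\<close>
  have PA: "P (A *v v) = P (A *v (P v))" for v
    using P(3)[OF controllable_subspace_invariant[OF P(2)], of v]
    by (simp add: matrix_vector_mult_diff_distrib linear_diff[OF P(1)])
  \<comment> \<open>The bound on \<open>T\<close> gives \<open>K * T \<le> 1 / 2\<close>, and
    \<open>L\<close> converts the estimate for \<open>P x\<close> into one for
    \<open>x\<close>.\<close>
  have "norm (P x0) / (2 * L) \<le> norm (x T)"
    if T: "0 < T" "T < 1 / (2 * K)" and x: "trajectory A B1 B2 C1 D1 C2 D2 T u \<xi> x z y" "x 0 = x0"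
    for T u \<xi> x z y and C1 :: "real ^ 'n ^ 'h" and D1 and C2 :: "real ^ 'n ^ 'l" and D2
  proof -
    have "norm (P (x 0)) \<le> 2 * norm (P (x T))"
    proof (rule norm_initial_le_norm_final[where K = K and M = "\<lambda>v. P (A *v v)"])
      fix t assume "t \<in> {0..T}"
      then have "((\<lambda>s. A *v x s + B1 *v u s + B2 *v \<xi> s) has_integral (x t - x 0)) {0..t}"
        using x(1) by (auto simp: trajectory_def)
      from has_integral_linear[OF this bl]
      show "((\<lambda>s. P (A *v P (x s))) has_integral (P (x t) - P (x 0))) {0..t}"
        by (simp add: o_def PB PA[symmetric] linear_diff[OF P(1)])
    qed (use K T in \<open>auto simp: field_simps\<close>)
    also have "\<dots> \<le> 2 * (L * norm (x T))" using L(2) by simp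
    finally show ?thesis using L(1) x(2) by (simp add: field_simps)
  qed
  moreover have "0 < 1 / (2 * K)" "0 < norm (P x0) / (2 * L)"
    using K(1) L(1) \<open>P x0 \<noteq> 0\<close> by auto
  ultimately show ?thesis using that by blast
qed

text \<open>Each summand of the cost is at least \<open>c\<^sup>2 / \<epsilon>\<close>, hence so is
  every average. The single value \<open>d = 1\<close> already makes the supremum infinite.\<close>

lemma not_possibly_controllable_on:
  fixes A :: "real ^ 'n ^ 'n" and B1 :: "real ^ 'm ^ 'n" and B2 :: "real ^ 'r ^ 'n"
    and C1 :: "real ^ 'n ^ 'h" and D1 :: "real ^ 'm ^ 'h"
    and C2 :: "real ^ 'n ^ 'l" and D2 :: "real ^ 'r ^ 'l"
  assumes c: "0 < c" and x: "\<And>u \<xi> x z y. trajectory A B1 B2 C1 D1 C2 D2 T u \<xi> x z y \<Longrightarrow>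
      x 0 = x0 \<Longrightarrow> c \<le> norm (x T)"
  shows "\<not> possibly_controllable_on A B1 B2 C1 D1 C2 D2 x0 T"
proof
  assume "possibly_controllable_on A B1 B2 C1 D1 C2 D2 x0 T"
  moreover have "possible_controllability_function A B1 B2 C1 D1 C2 D2 1 x0 T
     \<le> (SUP d\<in>{0<..}. possible_controllability_function A B1 B2 C1 D1 C2 D2 d x0 T)"
    by (intro SUP_upper) simp
  ultimately have "possible_controllability_function A B1 B2 C1 D1 C2 D2 1 x0 T < \<infinity>"
    unfolding possibly_controllable_on_def by (auto intro: le_less_trans)
  then obtain M :: real where M: "possible_controllability_function A B1 B2 C1 D1 C2 D2 1 x0 T < M"
    by (auto simp: less_PInf_Ex_of_nat)
  \<comment> \<open>Makes the lower bound equal to \<open>max M 1\<close>, contradicting the strict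
    upper bound \<open>M\<close>; the maximum keeps \<epsilon> positive.\<close>
  define \<epsilon> where "\<epsilon> = c\<^sup>2 / max M 1"
  have "0 < \<epsilon>" using c by (simp add: \<epsilon>_def)
  have "ereal (c\<^sup>2 / \<epsilon>) \<le> Inf {ereal (averaged_cost \<epsilon> T q u x) | q u \<xi> x z y.
      q \<ge> 1 \<and> admissible A B1 B2 C1 D1 C2 D2 1 x0 T q u \<xi> x z y}"
  proof (intro Inf_greatest, clarify, subst ereal_less_eq)
    fix q u \<xi> x z y
    assume q: "1 \<le> q" and adm: "admissible A B1 B2 C1 D1 C2 D2 1 x0 T q u \<xi> x z y"
    have "c\<^sup>2 / \<epsilon> \<le> (norm (x i T))\<^sup>2 / \<epsilon> + (LINT t|lebesgue_on {0..T}. (norm (u i t))\<^sup>2)"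
      if "i \<in> {1..q}" for i
    proof -
      have "c \<le> norm (x i T)"
        using adm that assms(2) unfolding admissible_def by blast
      then have "c\<^sup>2 / \<epsilon> \<le> (norm (x i T))\<^sup>2 / \<epsilon>"
        using c \<open>0 < \<epsilon>\<close> by (intro divide_right_mono power_mono) auto
      moreover have "0 \<le> (LINT t|lebesgue_on {0..T}. (norm (u i t))\<^sup>2)" by simp
      ultimately show ?thesis by linarith
    qed
    then have "real q * (c\<^sup>2 / \<epsilon>) \<le>
        (\<Sum>i=1..q. (norm (x i T))\<^sup>2 / \<epsilon> + (LINT t|lebesgue_on {0..T}. (norm (u i t))\<^sup>2))"
      using sum_bounded_below[of "{1..q}" "c\<^sup>2 / \<epsilon>"] by simp
    then show "c\<^sup>2 / \<epsilon> \<le> averaged_cost \<epsilon> T q u x"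
      using q by (simp add: averaged_cost_def field_simps)
  qed
  also have "\<dots> \<le> possible_controllability_function A B1 B2 C1 D1 C2 D2 1 x0 T"
    unfolding possible_controllability_function_def using \<open>0 < \<epsilon>\<close> by (intro SUP_upper) simp
  also note M
  finally have "c\<^sup>2 / \<epsilon> < M" by simp
  then show False using c by (simp add: \<epsilon>_def)
qed

theorem theorem6:
  fixes A :: "real ^ 'n ^ 'n" and B1 :: "real ^ 'm ^ 'n" and B2 :: "real ^ 'r ^ 'n"
    and C1 :: "real ^ 'n ^ 'h" and D1 :: "real ^ 'm ^ 'h"
    and C2 :: "real ^ 'n ^ 'l" and D2 :: "real ^ 'r ^ 'l"
    and x0 :: "real ^ 'n"
  assumes "transfer_function_nonzero A B1 C1 D1"
    and "x0 \<noteq> 0"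
  shows "differentially_possibly_controllable A B1 B2 C1 D1 C2 D2 x0 \<longleftrightarrow>
         controllable_state A (block_row B1 B2) x0"
proof
  assume *: "differentially_possibly_controllable A B1 B2 C1 D1 C2 D2 x0"
  show "controllable_state A (block_row B1 B2) x0"
  proof (rule ccontr)
    assume "\<not> controllable_state A (block_row B1 B2) x0"
    then obtain \<delta> c where "0 < \<delta>" and c: "0 < c"
      "\<And>T (C1 :: real ^ 'n ^ 'h) D1 (C2 :: real ^ 'n ^ 'l) D2 u \<xi> x z y. 0 < T \<Longrightarrow> T < \<delta> \<Longrightarrow>
         trajectory A B1 B2 C1 D1 C2 D2 T u \<xi> x z y \<Longrightarrow> x 0 = x0 \<Longrightarrow> c \<le> norm (x T)"
      by (rule uncontrollable_part_persists) blast
    obtain b where b: "0 < b" "\<And>T. 0 < T \<Longrightarrow> T < b \<Longrightarrow> possibly_controllable_on A B1 B2 C1 D1 C2 D2 x0 T"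
      using * unfolding differentially_possibly_controllable_def eventually_at_right_field by auto
    obtain T where T: "0 < T" "T < min \<delta> b"
      using dense[of 0 "min \<delta> b"] \<open>0 < \<delta>\<close> b(1) by auto
    have "\<not> possibly_controllable_on A B1 B2 C1 D1 C2 D2 x0 T"
      by (rule not_possibly_controllable_on[OF c(1)], rule c(2)) (use T in auto)
    then show False using b(2)[of T] T by simp
  qed
next
  assume "controllable_state A (block_row B1 B2) x0"
  \<comment> \<open>Sufficiency holds for every positive \<open>T\<close>, not only for small
    ones.\<close>
  then show "differentially_possibly_controllable A B1 B2 C1 D1 C2 D2 x0"
    unfolding differentially_possibly_controllable_def
    by (intro eventually_mono[OF eventually_at_right_less]
        possibly_controllable_on_if_controllable_state[OF assms])
qed

end
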